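(* Fix $n\in\mathbb N$. Let $0<p_1,\ldots,p_n<1$ be such that $\sum_{i=1}^n p_i=1$. Let $\mathcal X$ be a random subset of $[n]=\{1,\ldots,n\}$ with $\mathbb P\{\mathcal X=\{i\}\}=p_i$ for $i=1,\ldots,n$. Then, for real $\alpha\ge0$, $\mathcal X_\alpha$ exists if and only if $\alpha\in\{0,1,\ldots,n-2\}\cup[n-1,\infty)$.
   Context: A random subset $\mathcal X$ of $[n]$ is a random variable taking values in the set of all subsets of $[n]$ (the empty set is allowed as a value). Its void functional is $V_{\mathcal X}(K)=\mathbb P\{\mathcal X\cap K=\emptyset\}$, $K\subseteq[n]$. For $\alpha\ge0$, we say that $\mathcal X_\alpha$ exists if there is a random subset $\mathcal Y$ of $[n]$ (on some probability space) with $V_{\mathcal Y}(K)=V_{\mathcal X}(K)^\alpha$ for all $K\subseteq[n]$. Here $0^0=1$ and $0^\alpha=0$ for $\alpha>0$, so that $V_{\mathcal X}^0\equiv1$. *)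

theory Defs
  imports "HOL-Probability.Probability"
begin

definition random_subset :: "nat \<Rightarrow> 'a measure \<Rightarrow> ('a \<Rightarrow> nat set) \<Rightarrow> bool" where
  "random_subset n M X \<longleftrightarrow> prob_space M \<and> X \<in> measurable M (count_space (Pow {1..n}))"

definition void_functional :: "'a measure \<Rightarrow> ('a \<Rightarrow> nat set) \<Rightarrow> nat set \<Rightarrow> real" where
  "void_functional M X K = measure M {\<omega> \<in> space M. X \<omega> \<inter> K = {}}"

(* The library has 0 powr 0 = 0, whereas here 0 to the power 0 is 1. *)
definition rpow :: "real \<Rightarrow> real \<Rightarrow> real" where
  "rpow x a = (if a = 0 then 1 else x powr a)"

(* "On some probability space" would quantify over types. The sample space is therefore taken
   in the fixed type nat set; random_subset_canonical shows that this is no restriction. *)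
definition power_exists :: "nat \<Rightarrow> 'a measure \<Rightarrow> ('a \<Rightarrow> nat set) \<Rightarrow> real \<Rightarrow> bool" where
  "power_exists n M X \<alpha> \<longleftrightarrow>
     (\<exists>(N :: nat set measure) Y. random_subset n N Y \<and>
        (\<forall>K \<subseteq> {1..n}. void_functional N Y K = rpow (void_functional M X K) \<alpha>))"

lemma random_subset_canonical:
  fixes N :: "'b measure"
  assumes "random_subset n N Y"
  shows "\<exists>(N' :: nat set measure) Y'. random_subset n N' Y' \<and>
           void_functional N' Y' = void_functional N Y"
proof -
  let ?C = "count_space (Pow {1..n})"
  let ?N' = "distr N ?C Y"
  have Y: "Y \<in> measurable N ?C" and N: "prob_space N"
    using assms by (auto simp: random_subset_def)
  have "random_subset n ?N' (\<lambda>S. S)"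
    using prob_space.prob_space_distr[OF N Y] by (simp add: random_subset_def)
  moreover have "void_functional ?N' (\<lambda>S. S) K = void_functional N Y K" for K
  proof -
    have "Y -` {S \<in> Pow {1..n}. S \<inter> K = {}} \<inter> space N = {\<omega> \<in> space N. Y \<omega> \<inter> K = {}}"
      using measurable_space[OF Y] by auto
    moreover have "{S \<in> Pow {1..n}. S \<inter> K = {}} \<in> sets ?C"
      by auto
    ultimately show ?thesis
      unfolding void_functional_def
      using measure_distr[OF Y, of "{S \<in> Pow {1..n}. S \<inter> K = {}}"] by simp
  qed
  ultimately show ?thesis by blast
qed

end

theory Submission
  imports Defs
begin

text \<open>
  Since the point masses \<open>p i\<close> exhaust the total mass, \<open>X\<close> is almost surely a singleton, and so the
  probability that \<open>X\<close> misses \<open>K\<close> is \<open>p(A) = (\<Sum>i\<in>A. p i)\<close> with \<open>A = {1..n} - K\<close>.  A random subset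
  \<open>Y\<close> misses \<open>K\<close> iff \<open>Y \<subseteq> A\<close>, and the probabilities of the events \<open>Y \<subseteq> A\<close> determine those of \<open>Y = A\<close>
  by Moebius inversion over the Boolean lattice.  Hence the power of order \<open>\<alpha>\<close> exists iff the Moebius
  inverse of \<open>A \<mapsto> p(A)\<^sup>\<alpha>\<close> is nonnegative on all subsets of \<open>{1..n}\<close>
  (\<open>random_subset_exists_iff\<close>, \<open>void_functional_singleton\<close>).

  For \<open>\<alpha> = 0\<close> the inverse is \<open>1\<close> at the empty set and \<open>0\<close> elsewhere, the law of the empty random
  set.  Let \<open>\<alpha> > 0\<close>.  At the empty set the inverse is \<open>0\<close>.  At \<open>A\<close> with \<open>k > 0\<close>
  elements the inverse is the mixed difference of order \<open>k\<close> of the function \<open>x \<mapsto> x\<^sup>\<alpha>\<close> at \<open>0\<close>, with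
  the positive steps \<open>p i\<close>, \<open>i \<in> A\<close>.  By iterated use of the mean
  value theorem it has the sign of the \<open>k\<close>-th derivative, that is, of the falling factorial
  \<open>\<alpha> (\<alpha> - 1) \<cdots> (\<alpha> - k + 1)\<close> (\<open>moebius_powr\<close>, \<open>moebius_powr_0\<close>).  These falling factorials are
  nonnegative for all \<open>k \<le> n\<close> if \<open>\<alpha>\<close> is a natural number or \<open>\<alpha> \<ge> n - 1\<close>.  Otherwise
  \<open>k = \<lfloor>\<alpha>\<rfloor> + 2\<close> is at most \<open>n\<close>, and exactly the last of the \<open>k\<close> factors is negative.
\<close>

section \<open>Moebius inversion over subsets\<close>

definition moebius_inv :: "('i set \<Rightarrow> real) \<Rightarrow> 'i set \<Rightarrow> real" where
  "moebius_inv F A = (\<Sum>B\<in>Pow A. (-1) ^ (card A - card B) * F B)"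

lemma moebius_empty [simp]: "moebius_inv F {} = F {}"
  by (simp add: moebius_inv_def)

lemma moebius_cong: "(\<And>B. B \<subseteq> A \<Longrightarrow> F B = G B) \<Longrightarrow> moebius_inv F A = moebius_inv G A"
  by (auto simp: moebius_inv_def intro!: sum.cong)

text \<open>This recursion exhibits \<open>moebius_inv\<close> as an iterated difference operator, one difference for
  each element of the set.\<close>

lemma moebius_insert:
  assumes "finite A" "i \<notin> A"
  shows "moebius_inv F (insert i A) = moebius_inv (\<lambda>B. F (insert i B)) A - moebius_inv F A"
proof -
  have inj: "inj_on (insert i) (Pow A)"
    using assms(2) by (auto simp: inj_on_def)
  have "moebius_inv F (insert i A) =
      (\<Sum>B\<in>Pow A. (-1) ^ (card (insert i A) - card B) * F B) +
      (\<Sum>B\<in>insert i ` Pow A. (-1) ^ (card (insert i A) - card B) * F B)"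
    unfolding moebius_inv_def Pow_insert
    by (rule sum.union_disjoint) (use assms in auto)
  also have "(\<Sum>B\<in>insert i ` Pow A. (-1) ^ (card (insert i A) - card B) * F B) =
      moebius_inv (\<lambda>B. F (insert i B)) A"
    unfolding moebius_inv_def sum.reindex[OF inj] o_def
  proof (rule sum.cong)
    fix B assume "B \<in> Pow A"
    then have "finite B" "i \<notin> B" using assms finite_subset by auto
    then show "(-1) ^ (card (insert i A) - card (insert i B)) * F (insert i B) =
        (-1) ^ (card A - card B) * F (insert i B)"
      using assms by simp
  qed simp
  also have "(\<Sum>B\<in>Pow A. (-1) ^ (card (insert i A) - card B) * F B) = - moebius_inv F A"
    unfolding moebius_inv_def sum_negf[symmetric]
  proof (rule sum.cong)
    fix B assume "B \<in> Pow A"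
    then have "card B \<le> card A" using assms(1) by (auto intro: card_mono)
    then show "(-1) ^ (card (insert i A) - card B) * F B = - ((-1) ^ (card A - card B) * F B)"
      using assms by (simp add: Suc_diff_le)
  qed simp
  finally show ?thesis by simp
qed

lemma moebius_const:
  assumes "finite A" "A \<noteq> {}"
  shows "moebius_inv (\<lambda>_. c) A = 0"
proof -
  obtain i where "i \<in> A" using assms(2) by auto
  then have "moebius_inv (\<lambda>_. c) (insert i (A - {i})) = 0"
    using assms(1) by (subst moebius_insert) auto
  then show ?thesis using \<open>i \<in> A\<close> by (simp add: insert_absorb)
qed

lemma sum_moebius:
  assumes "finite A"
  shows "(\<Sum>B\<in>Pow A. moebius_inv F B) = F A"
proof -
  \<comment> \<open>The symmetric inversion formula carries the sign \<open>(-1) ^ card T\<close> in both directions.\<close>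
  have "(-1) ^ card S * moebius_inv F S = (\<Sum>T\<in>Pow S. (-1) ^ card T * F T)" if "finite S" for S
    unfolding moebius_inv_def sum_distrib_left
  proof (rule sum.cong)
    fix T assume "T \<in> Pow S"
    then have "card T \<le> card S" using that by (auto intro: card_mono)
    then have "even (card S + (card S - card T)) = even (card T)" by auto
    then have "(-1::real) ^ (card S + (card S - card T)) = (-1) ^ card T"
      by (simp add: minus_one_power_iff)
    then show "(-1) ^ card S * ((-1) ^ (card S - card T) * F T) = (-1) ^ card T * F T"
      by (simp add: power_add flip: mult.assoc)
  qed simp
  then have "F A = (\<Sum>T\<in>Pow A. (-1) ^ card T * ((-1) ^ card T * moebius_inv F T))"
    using assms by (rule inclusion_exclusion_symmetric)
  then show ?thesis by (simp flip: mult.assoc power_add)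
qed

lemma moebius_sum:
  assumes "finite A"
  shows "moebius_inv (\<lambda>B. \<Sum>C\<in>Pow B. q C) A = q A"
  unfolding moebius_inv_def
  using inclusion_exclusion_mobius[of "\<lambda>B. \<Sum>C\<in>Pow B. q C" q A] assms by simp

section \<open>Random subsets with a prescribed void functional\<close>

lemma void_functional_eq_sum:
  assumes "random_subset n N Y"
  shows "void_functional N Y K =
    (\<Sum>B\<in>Pow ({1..n} - K). measure N {\<omega> \<in> space N. Y \<omega> = B})"
proof -
  interpret prob_space N using assms by (simp add: random_subset_def)
  have Y: "Y \<in> measurable N (count_space (Pow {1..n}))"
    using assms by (simp add: random_subset_def)
  have sets: "{\<omega> \<in> space N. Y \<omega> = B} \<in> sets N" if "B \<in> Pow {1..n}" for B
  proof -
    have "Y -` {B} \<inter> space N \<in> sets N" using measurable_sets[OF Y] that by auto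
    also have "Y -` {B} \<inter> space N = {\<omega> \<in> space N. Y \<omega> = B}" by auto
    finally show ?thesis .
  qed
  have "{\<omega> \<in> space N. Y \<omega> \<inter> K = {}} = (\<Union>B\<in>Pow ({1..n} - K). {\<omega> \<in> space N. Y \<omega> = B})"
    using measurable_space[OF Y] by (auto 4 3)
  also have "measure N \<dots> = (\<Sum>B\<in>Pow ({1..n} - K). measure N {\<omega> \<in> space N. Y \<omega> = B})"
    using sets by (intro finite_measure_finite_Union) (auto simp: disjoint_family_on_def)
  finally show ?thesis unfolding void_functional_def .
qed

text \<open>The Moebius inverse of \<open>F\<close> is the only possible candidate for the point masses of \<open>Y\<close>, and
  conversely it defines a probability measure once it is nonnegative, because its total mass is
  \<open>F {1..n} = 1\<close>.\<close>

lemma random_subset_exists_iff: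
  assumes total: "F {1..n} = 1"
  shows "(\<exists>(N :: nat set measure) Y. random_subset n N Y \<and>
            (\<forall>K\<subseteq>{1..n}. void_functional N Y K = F ({1..n} - K)))
         \<longleftrightarrow> (\<forall>A\<subseteq>{1..n}. 0 \<le> moebius_inv F A)"
    (is "?L \<longleftrightarrow> ?R")
proof
  assume ?L
  then obtain N :: "nat set measure" and Y where Y: "random_subset n N Y"
    and F: "\<And>K. K \<subseteq> {1..n} \<Longrightarrow> void_functional N Y K = F ({1..n} - K)" by blast
  let ?q = "\<lambda>B. measure N {\<omega> \<in> space N. Y \<omega> = B}"
  show ?R
  proof (intro allI impI)
    fix A :: "nat set" assume A: "A \<subseteq> {1..n}"
    have "F B = (\<Sum>C\<in>Pow B. ?q C)" if "B \<subseteq> A" for B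
    proof -
      have "{1..n} - ({1..n} - B) = B" using that A by auto
      then show ?thesis
        using F[of "{1..n} - B"] void_functional_eq_sum[OF Y, of "{1..n} - B"] by simp
    qed
    then have "moebius_inv F A = moebius_inv (\<lambda>B. \<Sum>C\<in>Pow B. ?q C) A" by (rule moebius_cong)
    also have "\<dots> = ?q A" using finite_subset[OF A] by (intro moebius_sum) auto
    finally show "0 \<le> moebius_inv F A" by simp
  qed
next
  assume pos: ?R
  let ?N = "point_measure (Pow {1..n}) (moebius_inv F)"
  have meas: "measure ?N S = sum (moebius_inv F) S" if "S \<subseteq> Pow {1..n}" for S
    using that pos by (subst measure_point_measure_finite_if) auto
  have "(\<Sum>A\<in>Pow {1..n}. ennreal (moebius_inv F A)) = ennreal (\<Sum>A\<in>Pow {1..n}. moebius_inv F A)"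
    using pos by (intro sum_ennreal) auto
  then have "emeasure ?N (space ?N) = 1"
    using sum_moebius[of "{1..n}" F] total
    by (subst emeasure_point_measure_finite) (auto simp: space_point_measure)
  then have "prob_space ?N" by (rule prob_spaceI)
  then have "random_subset n ?N (\<lambda>S. S)" by (auto simp: random_subset_def)
  moreover have "void_functional ?N (\<lambda>S. S) K = F ({1..n} - K)" for K
  proof -
    have "{S \<in> space ?N. S \<inter> K = {}} = Pow ({1..n} - K)"
      by (auto simp: space_point_measure)
    then have "void_functional ?N (\<lambda>S. S) K = sum (moebius_inv F) (Pow ({1..n} - K))"
      unfolding void_functional_def by (simp only: meas[OF Pow_mono[OF Diff_subset]])
    also have "\<dots> = F ({1..n} - K)" by (intro sum_moebius) auto
    finally show ?thesis .
  qed
  ultimately show ?L by blast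
qed

text \<open>The prescribed point masses add up to the total mass, so all other values of \<open>X\<close> have
  probability zero.\<close>

lemma void_functional_singleton:
  assumes X: "random_subset n M X"
    and p: "\<And>i. i \<in> {1..n} \<Longrightarrow> measure M {\<omega> \<in> space M. X \<omega> = {i}} = p i"
    and total: "(\<Sum>i\<in>{1..n}. p i) = 1"
  shows "void_functional M X K = (\<Sum>i\<in>{1..n} - K. p i)"
proof -
  interpret prob_space M using X by (simp add: random_subset_def)
  let ?q = "\<lambda>B. measure M {\<omega> \<in> space M. X \<omega> = B}"
  have singles: "(\<Sum>B\<in>(\<lambda>i. {i}) ` A. ?q B) = (\<Sum>i\<in>A. p i)" if "A \<subseteq> {1..n}" for A
  proof -
    have "(\<Sum>B\<in>(\<lambda>i. {i}) ` A. ?q B) = (\<Sum>i\<in>A. ?q {i})"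
      by (subst sum.reindex) auto
    also have "\<dots> = (\<Sum>i\<in>A. p i)" using that p by (intro sum.cong) auto
    finally show ?thesis .
  qed
  have "sum ?q (Pow {1..n}) = 1"
    using void_functional_eq_sum[OF X, of "{}"] by (simp add: void_functional_def prob_space)
  moreover have "sum ?q (Pow {1..n}) =
      sum ?q (Pow {1..n} - (\<lambda>i. {i}) ` {1..n}) + sum ?q ((\<lambda>i. {i}) ` {1..n})"
    by (rule sum.subset_diff) auto
  ultimately have "sum ?q (Pow {1..n} - (\<lambda>i. {i}) ` {1..n}) = 0"
    using singles[of "{1..n}"] total by simp
  then have null: "?q B = 0" if "B \<in> Pow {1..n} - (\<lambda>i. {i}) ` {1..n}" for B
    using that by (subst (asm) sum_nonneg_eq_0_iff) auto
  have "void_functional M X K = sum ?q (Pow ({1..n} - K))"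
    by (rule void_functional_eq_sum[OF X])
  also have "\<dots> = sum ?q ((\<lambda>i. {i}) ` ({1..n} - K))"
    by (rule sum.mono_neutral_right) (auto intro!: null)
  also have "\<dots> = (\<Sum>i\<in>{1..n} - K. p i)" by (rule singles) auto
  finally show ?thesis .
qed

section \<open>The sign of the mixed differences of a power function\<close>

text \<open>Adding the element \<open>i\<close> takes one more difference with step \<open>h i\<close>, which the mean value theorem
  turns into a derivative.  The case \<open>x = 0\<close> is covered for \<open>a > 0\<close>, since then the power is continuous
  at \<open>0\<close> and differentiability is used only at points \<open>y > 0\<close>.\<close>

lemma moebius_powr_insert:
  fixes h :: "'i \<Rightarrow> real"
  assumes A: "finite A" "i \<notin> A" and h: "\<And>j. j \<in> insert i A \<Longrightarrow> 0 < h j"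
    and x: "0 < x \<or> x = 0 \<and> 0 < a"
  obtains y where "0 < y" and
    "moebius_inv (\<lambda>B. (x + sum h B) powr a) (insert i A) =
       h i * a * moebius_inv (\<lambda>B. (y + sum h B) powr (a - 1)) A"
proof -
  let ?D = "\<lambda>a y. moebius_inv (\<lambda>B. (y + sum h B) powr a) A"
  have hB: "0 \<le> sum h B" if "B \<subseteq> A" for B
    using that h by (intro sum_nonneg) (auto intro: less_imp_le)
  have i: "0 < h i" using h by simp
  have "continuous_on {x..x + h i} (?D a)"
    unfolding moebius_inv_def
  proof (intro continuous_on_sum continuous_on_mult_left continuous_on_powr'
      continuous_on_add continuous_on_id continuous_on_const ballI)
    fix B y assume "B \<in> Pow A" "y \<in> {x..x + h i}"
    then have "0 \<le> y" "y = 0 \<longrightarrow> 0 < a" "0 \<le> sum h B" using x hB by auto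
    then show "0 \<le> y + sum h B \<and> (y + sum h B = 0 \<longrightarrow> 0 < a)" by auto
  qed
  moreover have "(?D a has_derivative (\<lambda>t. (a * ?D (a - 1) y) * t)) (at y)"
    if "x < y" "y < x + h i" for y
  proof -
    have "((\<lambda>y. (-1) ^ (card A - card B) * (y + sum h B) powr a) has_real_derivative
        (-1) ^ (card A - card B) * (a * (y + sum h B) powr (a - 1))) (at y)"
      if "B \<in> Pow A" for B
    proof -
      have "0 < y + sum h B" using hB[of B] that x \<open>x < y\<close> by auto
      then show ?thesis by (auto intro!: derivative_eq_intros)
    qed
    then have "(?D a has_real_derivative
        (\<Sum>B\<in>Pow A. (-1) ^ (card A - card B) * (a * (y + sum h B) powr (a - 1)))) (at y)"
      unfolding moebius_inv_def by (rule DERIV_sum)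
    also have "(\<Sum>B\<in>Pow A. (-1) ^ (card A - card B) * (a * (y + sum h B) powr (a - 1))) =
        a * ?D (a - 1) y"
      by (simp add: moebius_inv_def sum_distrib_left mult_ac)
    finally show ?thesis by (simp add: has_field_derivative_def)
  qed
  ultimately obtain y where y: "x < y" "y < x + h i"
    and mv: "?D a (x + h i) - ?D a x = a * ?D (a - 1) y * (x + h i - x)"
    using i by (elim mvt[rotated]) auto
  have "moebius_inv (\<lambda>B. (x + sum h (insert i B)) powr a) A = ?D a (x + h i)"
  proof (rule moebius_cong)
    fix B assume "B \<subseteq> A"
    then have "finite B" "i \<notin> B" using A finite_subset by auto
    then show "(x + sum h (insert i B)) powr a = (x + h i + sum h B) powr a"
      by (simp add: add.assoc)
  qed
  then have "moebius_inv (\<lambda>B. (x + sum h B) powr a) (insert i A) = h i * a * ?D (a - 1) y"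
    using mv by (simp add: moebius_insert[OF A])
  moreover have "0 < y" using x y by auto
  ultimately show thesis by (rule that[rotated])
qed

lemma falling_factorial_shift:
  "a * (\<Prod>j<k. a - 1 - real j) = (\<Prod>j<Suc k. a - real j)"
  by (subst prod.lessThan_Suc_shift) (simp add: algebra_simps)

text \<open>Each difference replaces the exponent \<open>a\<close> by \<open>a - 1\<close> and contributes a factor \<open>a\<close>, so the
  induction is over all exponents and base points; the steps \<open>h i\<close> and the final power make up the
  positive factor \<open>r\<close>.\<close>

lemma moebius_powr:
  fixes h :: "'i \<Rightarrow> real"
  assumes "finite A" "\<And>i. i \<in> A \<Longrightarrow> 0 < h i" "0 < x"
  shows "\<exists>r>0. moebius_inv (\<lambda>B. (x + sum h B) powr a) A = (\<Prod>j<card A. a - real j) * r"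
  using assms
proof (induction A arbitrary: a x rule: finite_induct)
  case empty
  then show ?case by (auto intro!: exI[of _ "x powr a"])
next
  case (insert i A)
  obtain y where y: "0 < y" and eq: "moebius_inv (\<lambda>B. (x + sum h B) powr a) (insert i A) =
      h i * a * moebius_inv (\<lambda>B. (y + sum h B) powr (a - 1)) A"
    using moebius_powr_insert[of A i h x a] insert by metis
  obtain r where "0 < r"
    and "moebius_inv (\<lambda>B. (y + sum h B) powr (a - 1)) A = (\<Prod>j<card A. a - 1 - real j) * r"
    using insert.IH[of y "a - 1"] y insert.prems by auto
  then have "moebius_inv (\<lambda>B. (x + sum h B) powr a) (insert i A) =
      (\<Prod>j<card (insert i A). a - real j) * (h i * r)"
    using eq insert.hyps by (simp add: falling_factorial_shift[symmetric] del: prod.lessThan_Suc)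
  moreover have "0 < h i * r" using \<open>0 < r\<close> insert.prems by simp
  ultimately show ?case by blast
qed

text \<open>Only the first difference has to be taken from the base point \<open>0\<close>; it moves the base point to a
  positive \<open>y\<close>, where the exponent may become negative without harm.\<close>

lemma moebius_powr_0:
  fixes h :: "'i \<Rightarrow> real"
  assumes "finite A" "A \<noteq> {}" "\<And>i. i \<in> A \<Longrightarrow> 0 < h i" "0 < a"
  shows "\<exists>r>0. moebius_inv (\<lambda>B. sum h B powr a) A = (\<Prod>j<card A. a - real j) * r"
proof -
  obtain i where "i \<in> A" using assms(2) by auto
  define C where "C = A - {i}"
  have C: "A = insert i C" "i \<notin> C" "finite C"
    using \<open>i \<in> A\<close> assms(1) by (auto simp: C_def)
  obtain y where y: "0 < y" and eq: "moebius_inv (\<lambda>B. (0 + sum h B) powr a) A =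
      h i * a * moebius_inv (\<lambda>B. (y + sum h B) powr (a - 1)) C"
    using moebius_powr_insert[of C i h 0 a] assms C by metis
  obtain r where "0 < r"
    and "moebius_inv (\<lambda>B. (y + sum h B) powr (a - 1)) C = (\<Prod>j<card C. a - 1 - real j) * r"
    using moebius_powr[of C h y "a - 1"] y assms C by auto
  then have "moebius_inv (\<lambda>B. sum h B powr a) A = (\<Prod>j<card A. a - real j) * (h i * r)"
    using eq C by (simp add: falling_factorial_shift[symmetric] del: prod.lessThan_Suc)
  moreover have "0 < h i * r" using \<open>0 < r\<close> assms(3) \<open>i \<in> A\<close> by simp
  ultimately show ?thesis by blast
qed

lemma falling_factorial_nonneg:
  assumes "a \<in> \<nat> \<or> real k - 1 \<le> a"
  shows "0 \<le> (\<Prod>j<k. a - real j)"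
proof (cases "real k - 1 \<le> a")
  case True
  then show ?thesis by (intro prod_nonneg) auto
next
  case False
  then obtain m where "a = real m" using assms by (auto elim: Nats_cases)
  then have "m \<in> {..<k}" "a - real m = 0" using False by auto
  then have "(\<Prod>j<k. a - real j) = 0" by (intro prod_zero bexI[of _ m]) auto
  then show ?thesis by (simp only: order_refl)
qed

lemma falling_factorial_neg:
  assumes "0 \<le> a" "a \<notin> \<nat>"
  shows "(\<Prod>j<nat \<lfloor>a\<rfloor> + 2. a - real j) < 0"
proof -
  let ?m = "nat \<lfloor>a\<rfloor>"
  have "real ?m \<noteq> a" using assms(2) by (metis of_nat_in_Nats)
  then have m: "real ?m < a" "a < real ?m + 1" using assms(1) by linarith+
  have "0 < (\<Prod>j<Suc ?m. a - real j)"
  proof (intro prod_pos)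
    fix j assume "j \<in> {..<Suc ?m}"
    then have "real j \<le> real ?m" by (simp only: lessThan_iff less_Suc_eq_le of_nat_le_iff)
    then show "0 < a - real j" using m by linarith
  qed
  moreover have "a - real (Suc ?m) < 0" using m(2) unfolding of_nat_Suc by linarith
  ultimately have "(\<Prod>j<Suc ?m. a - real j) * (a - real (Suc ?m)) < 0"
    by (rule mult_pos_neg)
  then show ?thesis by (simp only: add_2_eq_Suc' prod.lessThan_Suc)
qed

section \<open>Which powers exist\<close>

theorem theorem11:
  fixes n :: nat and p :: "nat \<Rightarrow> real"
    and M :: "'a measure" and X :: "'a \<Rightarrow> nat set" and \<alpha> :: real
  assumes "\<And>i. i \<in> {1..n} \<Longrightarrow> 0 < p i \<and> p i < 1"
    and "(\<Sum>i\<in>{1..n}. p i) = 1"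
    and "random_subset n M X"
    and "\<And>i. i \<in> {1..n} \<Longrightarrow> measure M {\<omega> \<in> space M. X \<omega> = {i}} = p i"
    and "\<alpha> \<ge> 0"
  shows "power_exists n M X \<alpha> \<longleftrightarrow> \<alpha> \<in> {real k | k :: nat. k + 2 \<le> n} \<union> {real n - 1..}"
proof -
  let ?S = "{real k | k :: nat. k + 2 \<le> n} \<union> {real n - 1..}"
  let ?F = "\<lambda>A. rpow (sum p A) \<alpha>"
  have pos: "0 < p i" if "i \<in> {1..n}" for i using assms(1) that by blast
  have "?F {1..n} = 1" using assms(2) by (simp add: rpow_def)
  moreover have "void_functional M X K = sum p ({1..n} - K)" for K
    using void_functional_singleton[of n M X p K] assms(2,3,4) by blast
  ultimately have iff: "power_exists n M X \<alpha> \<longleftrightarrow> (\<forall>A\<subseteq>{1..n}. 0 \<le> moebius_inv ?F A)"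
    unfolding power_exists_def by (simp only: random_subset_exists_iff[where F = ?F, symmetric])
  show ?thesis
  proof (cases "\<alpha> = 0")
    case True
    have "0 \<le> moebius_inv ?F A" if "A \<subseteq> {1..n}" for A
      using that True moebius_const[of A 1] finite_subset[OF that]
      by (cases "A = {}") (auto simp: rpow_def)
    moreover have "0 \<in> ?S"
      by (cases "2 \<le> n") (auto intro: exI[of _ 0])
    ultimately show ?thesis using True iff by simp
  next
    case False
    then have \<alpha>: "0 < \<alpha>" using assms(5) by simp
    have sgn: "\<exists>r>0. moebius_inv ?F A = (\<Prod>j<card A. \<alpha> - real j) * r"
      if "A \<subseteq> {1..n}" "A \<noteq> {}" for A
      unfolding rpow_def if_not_P[OF False]
    proof (rule moebius_powr_0)
      show "finite A" using finite_subset[OF that(1)] by blast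
      show "0 < p i" if "i \<in> A" for i using pos that \<open>A \<subseteq> {1..n}\<close> by blast
    qed (use that(2) \<alpha> in blast)+
    show ?thesis unfolding iff
    proof
      assume S: "\<alpha> \<in> ?S"
      show "\<forall>A\<subseteq>{1..n}. 0 \<le> moebius_inv ?F A"
      proof (intro allI impI)
        fix A :: "nat set" assume A: "A \<subseteq> {1..n}"
        then have "card A \<le> n" using card_mono[OF _ A] by simp
        then have "\<alpha> \<in> \<nat> \<or> real (card A) - 1 \<le> \<alpha>" using S by auto
        then have ff: "0 \<le> (\<Prod>j<card A. \<alpha> - real j)" by (rule falling_factorial_nonneg)
        show "0 \<le> moebius_inv ?F A"
        proof (cases "A = {}")
          case True
          then show ?thesis by (simp add: rpow_def)
        next
          case False
          with sgn[OF A] obtain r where "0 < r"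
            "moebius_inv ?F A = (\<Prod>j<card A. \<alpha> - real j) * r" by blast
          then show ?thesis using ff by (metis mult_nonneg_nonneg less_imp_le)
        qed
      qed
    next
      assume nonneg: "\<forall>A\<subseteq>{1..n}. 0 \<le> moebius_inv ?F A"
      show "\<alpha> \<in> ?S"
      proof (rule ccontr)
        assume notin: "\<alpha> \<notin> ?S"
        \<comment> \<open>the least order whose falling factorial is negative\<close>
        let ?k = "nat \<lfloor>\<alpha>\<rfloor> + 2"
        have less: "\<alpha> < real n - 1" using notin by auto
        have "\<alpha> \<notin> \<nat>"
        proof
          assume "\<alpha> \<in> \<nat>"
          then obtain m where "\<alpha> = real m" by (auto elim: Nats_cases)
          then show False using notin less by auto
        qed
        then have neg: "(\<Prod>j<?k. \<alpha> - real j) < 0"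
          using falling_factorial_neg assms(5) by blast
        have "?k \<le> n" using less \<open>\<alpha> \<notin> \<nat>\<close> \<alpha> by linarith
        then have A: "{1..?k} \<subseteq> {1..n}" "{1..?k} \<noteq> {}" by auto
        obtain r where "0 < r" "moebius_inv ?F {1..?k} = (\<Prod>j<?k. \<alpha> - real j) * r"
          using sgn[OF A] unfolding card_atLeastAtMost diff_Suc_1 by blast
        then have "moebius_inv ?F {1..?k} < 0" using neg by (metis mult_neg_pos)
        moreover have "0 \<le> moebius_inv ?F {1..?k}" using nonneg A(1) by blast
        ultimately show False by linarith
      qed
    qed
  qed
qed

end
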